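(* Let $a>0$, let $$\Omega_a=\left\{(z_1,z_2)\in\mathbb{C}^2 : |z_2|\le\exp\!\left(\tfrac{|z_1|^2}{a}-a\right)\right\},\qquad E=\{(z_1,z_2)\in\mathbb{C}^2 : z_2=0\}.$$ Then on the domain $\Omega_a-E$ there exists a strictly plurisuperharmonic function $\psi_a$ with no critical points satisfying $\psi_a^{-1}(0)=\partial\Omega_a$ and $\psi_a^{-1}(\mathopen]-\infty,0\mathclose])=\Omega_a-E$.
   Context: A smooth real function $\psi$ on a complex manifold is strictly plurisuperharmonic if its complex Hessian $\sum_{\alpha,\beta}\frac{\partial^2\psi}{\partial z_\alpha\partial\bar z_\beta}\,dz_\alpha\otimes d\bar z_\beta$ is negative definite at every point, i.e. $-\psi$ is strictly plurisubharmonic. Here $\partial\Omega_a=\{|z_2|=\exp(|z_1|^2/a-a)\}$, and $\Omega_a-E$ is a manifold with boundary $\partial\Omega_a$. *)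

theory Defs
  imports "HOL-Analysis.Analysis"
begin

text \<open>In finite dimension, continuity of all directional derivatives gives a continuous
  Frechet derivative, so \<open>Ck_on k U\<close> on an open set is the usual class of \<open>k\<close> times
  continuously differentiable maps.\<close>

primrec Ck_on :: "nat \<Rightarrow> 'a::euclidean_space set \<Rightarrow> ('a \<Rightarrow> 'b::real_normed_vector) \<Rightarrow> bool" where
  "Ck_on 0 U f \<longleftrightarrow> continuous_on U f"
| "Ck_on (Suc k) U f \<longleftrightarrow>
     (\<forall>x\<in>U. f differentiable (at x)) \<and>
     (\<forall>v. Ck_on k U (\<lambda>x. frechet_derivative f (at x) v))"

definition smooth_on :: "'a::euclidean_space set \<Rightarrow> ('a \<Rightarrow> 'b::real_normed_vector) \<Rightarrow> bool" where
  "smooth_on U f \<longleftrightarrow> (\<forall>k. Ck_on k U f)"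

text \<open>A function on a subset \<open>S\<close> that need not be open (such as a domain with boundary) is smooth
  at \<open>p\<close> if near \<open>p\<close> it is the restriction of a smooth function \<open>g\<close> on an open set. If \<open>S\<close> is
  contained in the closure of its interior, all derivatives of \<open>g\<close> at \<open>p\<close> are determined
  by \<open>f\<close>.\<close>

definition local_smooth_extension ::
    "'a::euclidean_space set \<Rightarrow> ('a \<Rightarrow> 'b::real_normed_vector) \<Rightarrow> 'a \<Rightarrow> ('a \<Rightarrow> 'b) \<Rightarrow> bool" where
  "local_smooth_extension S f p g \<longleftrightarrow>
     (\<exists>U. open U \<and> p \<in> U \<and> smooth_on U g \<and> (\<forall>q\<in>S \<inter> U. g q = f q))"

text \<open>Wirtinger derivatives \<open>1/2 (d/dx - i d/dy)\<close> and \<open>1/2 (d/dx + i d/dy)\<close> in the coordinate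
  \<open>z $ \<alpha> = x + i y\<close>.\<close>

definition d_z :: "'n::finite \<Rightarrow> (complex ^ 'n \<Rightarrow> complex) \<Rightarrow> complex ^ 'n \<Rightarrow> complex" where
  "d_z \<alpha> f p = (frechet_derivative f (at p) (axis \<alpha> 1)
                - \<i> * frechet_derivative f (at p) (axis \<alpha> \<i>)) / 2"

definition d_zbar :: "'n::finite \<Rightarrow> (complex ^ 'n \<Rightarrow> complex) \<Rightarrow> complex ^ 'n \<Rightarrow> complex" where
  "d_zbar \<alpha> f p = (frechet_derivative f (at p) (axis \<alpha> 1)
                   + \<i> * frechet_derivative f (at p) (axis \<alpha> \<i>)) / 2"

definition complex_hessian ::
    "(complex ^ 'n::finite \<Rightarrow> real) \<Rightarrow> complex ^ 'n \<Rightarrow> 'n \<Rightarrow> 'n \<Rightarrow> complex" where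
  "complex_hessian g p \<alpha> \<beta> = d_z \<alpha> (d_zbar \<beta> (\<lambda>q. complex_of_real (g q))) p"

text \<open>For a Hermitian matrix \<open>H\<close>, such as the complex Hessian of a smooth real function, the sum
  below is real; \<open>Re\<close> only serves to compare it with \<open>0\<close>.\<close>

definition neg_definite :: "('n::finite \<Rightarrow> 'n \<Rightarrow> complex) \<Rightarrow> bool" where
  "neg_definite H \<longleftrightarrow>
     (\<forall>v :: complex ^ 'n. v \<noteq> 0 \<longrightarrow>
        Re (\<Sum>\<alpha>\<in>UNIV. \<Sum>\<beta>\<in>UNIV. H \<alpha> \<beta> * (v $ \<alpha>) * cnj (v $ \<beta>)) < 0)"

definition strictly_plurisuperharmonic_on ::
    "(complex ^ 'n::finite) set \<Rightarrow> (complex ^ 'n \<Rightarrow> real) \<Rightarrow> bool" where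
  "strictly_plurisuperharmonic_on S f \<longleftrightarrow>
     (\<forall>p\<in>S. \<exists>g. local_smooth_extension S f p g \<and> neg_definite (complex_hessian g p))"

definition critical_point_on ::
    "'a::euclidean_space set \<Rightarrow> ('a \<Rightarrow> real) \<Rightarrow> 'a \<Rightarrow> bool" where
  "critical_point_on S f p \<longleftrightarrow> p \<in> S \<and> (f has_derivative (\<lambda>v. 0)) (at p within S)"

definition Omega :: "real \<Rightarrow> (complex ^ 2) set" where
  "Omega a = {z. cmod (z $ 2) \<le> exp ((cmod (z $ 1))\<^sup>2 / a - a)}"

definition bd_Omega :: "real \<Rightarrow> (complex ^ 2) set" where
  "bd_Omega a = {z. cmod (z $ 2) = exp ((cmod (z $ 1))\<^sup>2 / a - a)}"

definition E :: "(complex ^ 2) set" where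
  "E = {z. z $ 2 = 0}"

end

theory Submission
  imports Defs
begin

text \<open>
  The function \<open>u = log |z\<^sub>2| - |z\<^sub>1|\<^sup>2 / a + a\<close> is a plurisuperharmonic defining function without
  critical points, but its complex Hessian vanishes in the direction of \<open>z\<^sub>2\<close>. Composing it with the
  increasing strictly concave function \<open>t \<mapsto> 1 - exp (-2 t)\<close> adds a negative multiple of
  \<open>|\<partial>u|\<^sup>2\<close>, which is positive in that direction. The exponent \<open>-2\<close> is chosen
  so that only the square of \<open>|z\<^sub>2|\<close> occurs.
\<close>

section \<open>Smooth functions\<close>

lemma frechet_derivative_cong_open:
  assumes "open U" "x \<in> U" "\<And>y. y \<in> U \<Longrightarrow> f y = g y"
  shows "frechet_derivative f (at x) = frechet_derivative g (at x)"
proof -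
  have "(f has_derivative D) (at x) \<longleftrightarrow> (g has_derivative D) (at x)" for D
    using has_derivative_transform_within_open[of _ _ x UNIV U] assms by (metis (no_types, lifting))
  then show ?thesis
    by (simp add: frechet_derivative_def)
qed

text \<open>Openness of \<open>U\<close> matters: the derivative at a point of \<open>U\<close>
  depends on values in a whole neighbourhood, on which \<open>f\<close> and \<open>g\<close> must
  agree.\<close>

lemma Ck_on_cong:
  assumes "open U" "\<And>x. x \<in> U \<Longrightarrow> f x = g x" "Ck_on k U f"
  shows "Ck_on k U g"
  using assms(2,3)
proof (induction k arbitrary: f g)
  case 0
  then show ?case
    by (metis Ck_on.simps(1) continuous_on_cong)
next
  case (Suc k)
  have "g differentiable at x" if "x \<in> U" for x
    using Suc.prems that \<open>open U\<close> has_derivative_transform_within_open[of f _ x UNIV U g]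
    unfolding Ck_on.simps differentiable_def by blast
  moreover have "Ck_on k U (\<lambda>x. frechet_derivative g (at x) v)" for v
    by (rule Suc.IH[where f = "\<lambda>x. frechet_derivative f (at x) v"])
       (use Suc.prems frechet_derivative_cong_open[OF \<open>open U\<close>, of _ f g] in auto)
  ultimately show ?case
    by simp
qed

text \<open>\<open>Ck_on\<close> refers to the chosen \<open>frechet_derivative\<close>. By
  uniqueness of derivatives any explicit formula \<open>D\<close> agrees with it on
  \<open>U\<close>, so regularity may be checked on \<open>D\<close>.\<close>

lemma Ck_on_SucI:
  assumes "open U" "\<And>x. x \<in> U \<Longrightarrow> (f has_derivative D x) (at x)"
    "\<And>v. Ck_on k U (\<lambda>x. D x v)"
  shows "Ck_on (Suc k) U f"
proof -
  have "D x v = frechet_derivative f (at x) v" if "x \<in> U" for x v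
    using assms(2)[OF that] by (metis frechet_derivative_at)
  then have "Ck_on k U (\<lambda>x. frechet_derivative f (at x) v)" for v
    by (rule Ck_on_cong[OF assms(1) _ assms(3)])
  then show ?thesis
    using assms(2) by (auto simp: differentiable_def)
qed

lemma Ck_on_Suc_has_derivative:
  assumes "Ck_on (Suc k) U f" "x \<in> U"
  shows "(f has_derivative frechet_derivative f (at x)) (at x)"
  using assms by (simp add: frechet_derivative_works)

text \<open>The derivative of a product contains the undifferentiated factors, so inductions on
  \<open>k\<close> need them one order lower as well.\<close>

lemma Ck_on_SucD: "Ck_on (Suc k) U f \<Longrightarrow> Ck_on k U f"
proof (induction k arbitrary: f)
  case 0
  then show ?case
    by (simp add: differentiable_at_imp_differentiable_on differentiable_imp_continuous_on)
next
  case (Suc k)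
  then show ?case
    by (metis Ck_on.simps(2))
qed

lemma Ck_on_const: "open U \<Longrightarrow> Ck_on k U (\<lambda>x. c)"
  by (induction k arbitrary: c) (auto intro!: Ck_on_SucI[where D = "\<lambda>x v. 0"])

lemma Ck_on_bounded_linear:
  assumes "open U" "bounded_linear f"
  shows "Ck_on k U f"
proof (cases k)
  case 0
  then show ?thesis
    using assms(2) by (simp add: linear_continuous_on)
next
  case (Suc j)
  show ?thesis
    unfolding Suc using assms
    by (intro Ck_on_SucI[where D = "\<lambda>x. f"] Ck_on_const bounded_linear_imp_has_derivative)
qed

lemma Ck_on_add:
  assumes "open U" "Ck_on k U f" "Ck_on k U g"
  shows "Ck_on k U (\<lambda>x. f x + g x)"
  using assms(2,3)
proof (induction k arbitrary: f g)
  case 0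
  then show ?case
    by (simp add: continuous_on_add)
next
  case (Suc k)
  show ?case
    by (rule Ck_on_SucI[OF \<open>open U\<close> has_derivative_add[OF
          Ck_on_Suc_has_derivative[OF Suc.prems(1)] Ck_on_Suc_has_derivative[OF Suc.prems(2)]]])
       (use Suc in auto)
qed

lemma Ck_on_mult:
  fixes f g :: "'a::euclidean_space \<Rightarrow> 'b::real_normed_algebra"
  assumes "open U" "Ck_on k U f" "Ck_on k U g"
  shows "Ck_on k U (\<lambda>x. f x * g x)"
  using assms(2,3)
proof (induction k arbitrary: f g)
  case 0
  then show ?case
    by (simp add: continuous_on_mult)
next
  case (Suc k)
  show ?case
    by (rule Ck_on_SucI[OF \<open>open U\<close> has_derivative_mult[OF
          Ck_on_Suc_has_derivative[OF Suc.prems(1)] Ck_on_Suc_has_derivative[OF Suc.prems(2)]]])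
       (use Suc Ck_on_SucD[OF Suc.prems(1)] Ck_on_SucD[OF Suc.prems(2)]
         in \<open>auto intro!: Ck_on_add[OF \<open>open U\<close>]\<close>)
qed

text \<open>The derivative of \<open>exp (f x)\<close> contains \<open>exp (f x)\<close> again, so
  the induction can keep \<open>f\<close> fixed. The same holds for \<open>inverse\<close>
  below.\<close>

lemma Ck_on_exp:
  fixes f :: "'a::euclidean_space \<Rightarrow> real"
  assumes "open U" "Ck_on k U f"
  shows "Ck_on k U (\<lambda>x. exp (f x))"
  using assms(2)
proof (induction k)
  case 0
  then show ?case
    by (simp add: continuous_on_exp)
next
  case (Suc k)
  show ?case
  proof (rule Ck_on_SucI[OF \<open>open U\<close>])
    show "((\<lambda>x. exp (f x)) has_derivative (\<lambda>v. exp (f x) * frechet_derivative f (at x) v)) (at x)"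
      if "x \<in> U" for x
      using Ck_on_Suc_has_derivative[OF Suc.prems that] by (auto intro!: derivative_eq_intros)
    show "Ck_on k U (\<lambda>x. exp (f x) * frechet_derivative f (at x) v)" for v
      using Suc.prems Ck_on_SucD[OF Suc.prems] by (intro Ck_on_mult Suc.IH \<open>open U\<close>) auto
  qed
qed

lemma Ck_on_inverse:
  fixes f :: "'a::euclidean_space \<Rightarrow> real"
  assumes "open U" "Ck_on k U f" "\<And>x. x \<in> U \<Longrightarrow> f x \<noteq> 0"
  shows "Ck_on k U (\<lambda>x. inverse (f x))"
  using assms(2)
proof (induction k)
  case 0
  then show ?case
    using assms(3) by (simp add: continuous_on_inverse)
next
  case (Suc k)
  show ?case
  proof (rule Ck_on_SucI[OF \<open>open U\<close>])
    show "((\<lambda>x. inverse (f x)) has_derivative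
        (\<lambda>v. (- 1) * (inverse (f x) * frechet_derivative f (at x) v * inverse (f x)))) (at x)"
      if "x \<in> U" for x
      using Deriv.has_derivative_inverse[OF assms(3)[OF that] Ck_on_Suc_has_derivative[OF Suc.prems that]]
      by simp
    show "Ck_on k U (\<lambda>x. (- 1) * (inverse (f x) * frechet_derivative f (at x) v * inverse (f x)))"
      for v
      using Suc.prems Ck_on_SucD[OF Suc.prems]
      by (intro Ck_on_mult Ck_on_const Suc.IH \<open>open U\<close>) auto
  qed
qed

lemma Ck_on_norm_component_squared:
  fixes U :: "(complex ^ 'n::finite) set"
  assumes "open U"
  shows "Ck_on k U (\<lambda>z. (cmod (z $ i))\<^sup>2)"
  \<comment> \<open>\<open>cmod\<close> fails to be smooth at 0, but its square is a polynomial in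
    the real-linear coordinates \<open>Re\<close> and \<open>Im\<close>.\<close>
  unfolding cmod_power2 unfolding power2_eq_square
  by (intro Ck_on_add Ck_on_mult Ck_on_bounded_linear assms bounded_linear_compose[OF bounded_linear_Re]
      bounded_linear_compose[OF bounded_linear_Im] bounded_linear_vec_nth)

section \<open>The defining function\<close>

text \<open>This is \<open>exp (- 2 * u)\<close> for the \<open>u\<close> above, written without a
  logarithm. The function sought is \<open>1 - defect a\<close>.\<close>

definition defect :: "real \<Rightarrow> complex ^ 2 \<Rightarrow> real" where
  "defect a z = exp (2 * ((cmod (z $ 1))\<^sup>2 / a - a)) * inverse ((cmod (z $ 2))\<^sup>2)"

text \<open>The differential of \<open>- 2 * u\<close>, the logarithm of \<open>defect a\<close>, at
  \<open>z\<close> off \<open>E\<close> in direction \<open>v\<close>. With it every derivative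
  keeps \<open>defect a z\<close> as a factor.\<close>

definition log_defect_deriv :: "real \<Rightarrow> complex ^ 2 \<Rightarrow> complex ^ 2 \<Rightarrow> real" where
  "log_defect_deriv a z v = 4 / a * (z $ 1 \<bullet> v $ 1) - 2 * Re (v $ 2 / z $ 2)"

lemma defect_eq_power2: "defect a z = (exp ((cmod (z $ 1))\<^sup>2 / a - a) / cmod (z $ 2))\<^sup>2"
  by (simp only: defect_def exp_double divide_inverse power_mult_distrib power_inverse)

lemma open_Compl_E: "open (- E)"
proof -
  have "closed {z :: complex ^ 2. z $ 2 = 0}"
    by (intro closed_Collect_eq continuous_intros)
  then show ?thesis
    by (simp add: E_def open_Compl)
qed

lemma smooth_on_defect: "smooth_on (- E) (\<lambda>z. 1 - defect a z)"
proof -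
  have "Ck_on k (- E) (\<lambda>z. 1 + (- 1) * (exp (2 * ((cmod (z $ 1))\<^sup>2 * inverse a + - a))
      * inverse ((cmod (z $ 2))\<^sup>2)))" for k
    by (intro Ck_on_add Ck_on_mult Ck_on_const Ck_on_exp Ck_on_inverse
        Ck_on_norm_component_squared open_Compl_E) (auto simp: E_def)
  then show ?thesis
    by (simp add: smooth_on_def defect_def divide_inverse)
qed

lemma has_derivative_norm_component_squared:
  "((\<lambda>z :: complex ^ 'n::finite. (cmod (z $ i))\<^sup>2) has_derivative (\<lambda>v. 2 * (z $ i \<bullet> v $ i))) (at z)"
  unfolding power2_norm_eq_inner
  by (auto intro!: derivative_eq_intros bounded_linear_imp_has_derivative simp: inner_commute)

lemma has_derivative_defect:
  assumes "z $ 2 \<noteq> 0"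
  shows "(defect a has_derivative (\<lambda>v. defect a z * log_defect_deriv a z v)) (at z)"
proof -
  have "Re (v $ 2 / z $ 2) = (z $ 2 \<bullet> v $ 2) * inverse ((cmod (z $ 2))\<^sup>2)" for v :: "complex ^ 2"
    by (simp add: Re_divide inner_complex_def cmod_power2 divide_inverse algebra_simps)
  \<comment> \<open>The two squared norms are replaced by arbitrary \<open>f\<close> and
    \<open>g\<close>, so that the derivative rules do not open them up.\<close>
  moreover have "((\<lambda>z. exp (c * f z - d) * inverse (g z)) has_derivative
      (\<lambda>v. exp (c * f z - d) * inverse (g z) * (c * f' v - g' v * inverse (g z)))) (at z)"
    if "(f has_derivative f') (at z)" "(g has_derivative g') (at z)" "g z \<noteq> 0"
    for f g :: "complex ^ 2 \<Rightarrow> real" and f' g' c d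
    by (rule derivative_eq_intros that refl)+ (simp add: fun_eq_iff algebra_simps)
  note this[OF has_derivative_norm_component_squared[of 1] has_derivative_norm_component_squared[of 2],
      of "2 / a" "2 * a"]
  ultimately show ?thesis
    using assms unfolding defect_def[abs_def] log_defect_deriv_def
    by (simp add: right_diff_distrib mult.assoc)
qed

section \<open>Wirtinger derivatives and the complex Hessian\<close>

lemma log_defect_deriv_axis:
  "log_defect_deriv a z (axis 1 1) = 4 / a * Re (z $ 1)"
  "log_defect_deriv a z (axis 1 \<i>) = 4 / a * Im (z $ 1)"
  "log_defect_deriv a z (axis 2 1) = - 2 * Re (inverse (z $ 2))"
  "log_defect_deriv a z (axis 2 \<i>) = 2 * Im (inverse (z $ 2))"
  by (simp_all add: log_defect_deriv_def axis_def inner_complex_def divide_inverse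
      del: inverse_complex.simps)

lemma frechet_derivative_of_real_psi:
  assumes "z $ 2 \<noteq> 0"
  shows "frechet_derivative (\<lambda>z. complex_of_real (1 - defect a z)) (at z)
    = (\<lambda>v. - of_real (defect a z * log_defect_deriv a z v))"
  by (rule frechet_derivative_at[symmetric])
     (auto intro!: derivative_eq_intros has_derivative_defect assms)

lemma d_zbar_psi_1:
  assumes "z $ 2 \<noteq> 0"
  shows "d_zbar 1 (\<lambda>z. complex_of_real (1 - defect a z)) z = of_real (defect a z) * (- of_real (2 / a) * z $ 1)"
  unfolding d_zbar_def frechet_derivative_of_real_psi[OF assms]
  by (simp add: complex_eq_iff log_defect_deriv_axis)

lemma d_zbar_psi_2:
  assumes "z $ 2 \<noteq> 0"
  shows "d_zbar 2 (\<lambda>z. complex_of_real (1 - defect a z)) z = of_real (defect a z) * inverse (cnj (z $ 2))"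
  unfolding d_zbar_def frechet_derivative_of_real_psi[OF assms]
  unfolding complex_cnj_inverse[symmetric] log_defect_deriv_axis
  by (simp add: complex_eq_iff del: inverse_complex.simps complex_cnj_inverse)

text \<open>Product rule for \<open>exp (- 2 * u) * G\<close>: the z-derivatives of
  \<open>- 2 * u\<close> are \<open>2 / a * cnj (z $ 1)\<close> and
  \<open>- inverse (z $ 2)\<close>. Both first derivatives of \<open>1 - defect a\<close> have this
  form, but only off \<open>E\<close>; hence the restricted hypothesis on \<open>F\<close>.\<close>

lemma d_z_defect_mult:
  assumes z: "z $ 2 \<noteq> 0"
    and F: "\<And>q. q $ 2 \<noteq> 0 \<Longrightarrow> F q = of_real (defect a q) * G q"
    and G: "(G has_derivative D) (at z)"
  shows "d_z 1 F z = of_real (defect a z) *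
      (of_real (2 / a) * cnj (z $ 1) * G z + (D (axis 1 1) - \<i> * D (axis 1 \<i>)) / 2)" (is ?th1)
    and "d_z 2 F z = of_real (defect a z) *
      (- inverse (z $ 2) * G z + (D (axis 2 1) - \<i> * D (axis 2 \<i>)) / 2)" (is ?th2)
proof -
  have "((\<lambda>q. of_real (defect a q) * G q) has_derivative
      (\<lambda>v. of_real (defect a z) * (of_real (log_defect_deriv a z v) * G z + D v))) (at z)"
    using has_derivative_mult[OF has_derivative_of_real[OF has_derivative_defect[OF z]] G]
    by (simp add: algebra_simps)
  then have "frechet_derivative (\<lambda>q. of_real (defect a q) * G q) (at z) =
      (\<lambda>v. of_real (defect a z) * (of_real (log_defect_deriv a z v) * G z + D v))"
    by (rule frechet_derivative_at[symmetric])
  moreover have "frechet_derivative F (at z) = frechet_derivative (\<lambda>q. of_real (defect a q) * G q) (at z)"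
    by (rule frechet_derivative_cong_open[OF open_Compl_E]) (use z F in \<open>auto simp: E_def\<close>)
  ultimately have D_F: "frechet_derivative F (at z) =
      (\<lambda>v. of_real (defect a z) * (of_real (log_defect_deriv a z v) * G z + D v))"
    by simp
  have 1: "(of_real (log_defect_deriv a z (axis 1 1)) - \<i> * of_real (log_defect_deriv a z (axis 1 \<i>))) / 2
      = of_real (2 / a) * cnj (z $ 1)"
    by (simp add: complex_eq_iff log_defect_deriv_axis)
  have 2: "(of_real (log_defect_deriv a z (axis 2 1)) - \<i> * of_real (log_defect_deriv a z (axis 2 \<i>))) / 2
      = - inverse (z $ 2)"
    unfolding log_defect_deriv_axis by (simp add: complex_eq_iff del: inverse_complex.simps)
  show ?th1
    unfolding d_z_def D_F 1[symmetric] by (simp add: field_simps)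
  show ?th2
    unfolding d_z_def D_F 2[symmetric] by (simp add: field_simps)
qed

lemma complex_hessian_psi:
  fixes a :: real
  assumes z: "z $ 2 \<noteq> 0"
  defines "H \<equiv> complex_hessian (\<lambda>z. 1 - defect a z) z"
  shows "H 1 1 = - of_real (defect a z) * (of_real (2 / a) + of_real (2 / a) * cnj (z $ 1) * (of_real (2 / a) * z $ 1))"
    and "H 2 1 = of_real (defect a z) * (of_real (2 / a) * z $ 1 * inverse (z $ 2))"
    and "H 1 2 = of_real (defect a z) * (of_real (2 / a) * cnj (z $ 1) * cnj (inverse (z $ 2)))"
    and "H 2 2 = - of_real (defect a z) * (inverse (z $ 2) * cnj (inverse (z $ 2)))"
proof -
  have G1: "((\<lambda>q. - of_real (2 / a) * q $ 1) has_derivative (\<lambda>v. - of_real (2 / a) * v $ 1)) (at z)"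
    by (intro bounded_linear_imp_has_derivative bounded_linear_vec_nth
        bounded_linear_compose[OF bounded_linear_mult_right])
  \<comment> \<open>This factor is antiholomorphic, so its derivative terms cancel in
    \<open>d_z\<close>. The factor in \<open>G1\<close> depends on \<open>z $ 1\<close> alone, so it
    contributes only to \<open>H 1 1\<close>.\<close>
  have G2: "((\<lambda>q. inverse (cnj (q $ 2))) has_derivative
      (\<lambda>v. - (inverse (cnj (z $ 2)) * cnj (v $ 2) * inverse (cnj (z $ 2))))) (at z)"
    using z by (auto intro!: Deriv.has_derivative_inverse bounded_linear_imp_has_derivative
        bounded_linear_compose[OF bounded_linear_cnj] bounded_linear_vec_nth)
  note H1 = d_z_defect_mult[OF z d_zbar_psi_1 G1] and H2 = d_z_defect_mult[OF z d_zbar_psi_2 G2]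
  show "H 1 1 = - of_real (defect a z) * (of_real (2 / a) + of_real (2 / a) * cnj (z $ 1) * (of_real (2 / a) * z $ 1))"
    unfolding H_def complex_hessian_def by (subst H1(1)) (auto simp: axis_def field_simps)
  show "H 2 1 = of_real (defect a z) * (of_real (2 / a) * z $ 1 * inverse (z $ 2))"
    unfolding H_def complex_hessian_def by (subst H1(2)) (auto simp: axis_def field_simps)
  show "H 1 2 = of_real (defect a z) * (of_real (2 / a) * cnj (z $ 1) * cnj (inverse (z $ 2)))"
    unfolding H_def complex_hessian_def by (subst H2(1)) (auto simp: axis_def field_simps)
  show "H 2 2 = - of_real (defect a z) * (inverse (z $ 2) * cnj (inverse (z $ 2)))"
    unfolding H_def complex_hessian_def by (subst H2(2)) (auto simp: axis_def field_simps)
qed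

section \<open>Negative definiteness and absence of critical points\<close>

lemma neg_definite_complex_hessian_psi:
  assumes "a > 0" "z $ 2 \<noteq> 0"
  shows "neg_definite (complex_hessian (\<lambda>z. 1 - defect a z) z)"
  unfolding neg_definite_def
proof (intro allI impI)
  fix v :: "complex ^ 2"
  assume "v \<noteq> 0"
  let ?H = "complex_hessian (\<lambda>z. 1 - defect a z) z"
  define c where "c = complex_of_real (2 / a)"
  define r where "r = inverse (z $ 2)"
  \<comment> \<open>The value on \<open>v\<close> of the (1,0)-part of the differential of
    \<open>- 2 * u\<close>. Its square comes from the concave composition, and the remaining term
    \<open>c * (v $ 1 * cnj (v $ 1))\<close> is the Hessian of \<open>- 2 * u\<close>.\<close>
  define w where "w = c * cnj (z $ 1) * v $ 1 - v $ 2 * r"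
  have [simp]: "cnj c = c"
    by (simp add: c_def)
  have "(\<Sum>\<alpha>\<in>UNIV. \<Sum>\<beta>\<in>UNIV. ?H \<alpha> \<beta> * (v $ \<alpha>) * cnj (v $ \<beta>))
      = - of_real (defect a z) * (c * (v $ 1 * cnj (v $ 1)) + w * cnj w)"
    unfolding sum_2 complex_hessian_psi[OF assms(2)] c_def[symmetric] r_def[symmetric] w_def
    by (simp add: algebra_simps)
  also have "\<dots> = of_real (- defect a z * (2 / a * (cmod (v $ 1))\<^sup>2 + (cmod w)\<^sup>2))"
    by (simp add: c_def flip: complex_norm_square)
  finally have sum_eq: "Re (\<Sum>\<alpha>\<in>UNIV. \<Sum>\<beta>\<in>UNIV. ?H \<alpha> \<beta> * (v $ \<alpha>) * cnj (v $ \<beta>))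
      = - defect a z * (2 / a * (cmod (v $ 1))\<^sup>2 + (cmod w)\<^sup>2)"
    by (metis Re_complex_of_real)
  \<comment> \<open>If \<open>v $ 1 = 0\<close>, then \<open>w = - (v $ 2) / z $ 2\<close>, so
    \<open>w\<close> controls exactly the direction in which the Hessian of \<open>u\<close>
    degenerates.\<close>
  have "v $ 1 \<noteq> 0 \<or> w \<noteq> 0"
    using \<open>v \<noteq> 0\<close> assms by (auto simp: w_def r_def vec_eq_iff forall_2)
  then have "2 / a * (cmod (v $ 1))\<^sup>2 + (cmod w)\<^sup>2 > 0"
    using \<open>a > 0\<close> by (auto intro: add_pos_nonneg add_nonneg_pos)
  moreover have "defect a z > 0"
    using assms by (simp add: defect_def)
  ultimately show "Re (\<Sum>\<alpha>\<in>UNIV. \<Sum>\<beta>\<in>UNIV. ?H \<alpha> \<beta> * (v $ \<alpha>) * cnj (v $ \<beta>)) < 0"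
    unfolding sum_eq by simp
qed

text \<open>At a boundary point only one-sided information is available; the real ray through \<open>z\<^sub>2\<close>,
  followed towards \<open>0\<close>, stays inside the domain.\<close>

lemma no_critical_point_psi: "\<not> critical_point_on (Omega a - E) (\<lambda>z. 1 - defect a z) p"
proof
  assume crit: "critical_point_on (Omega a - E) (\<lambda>z. 1 - defect a z) p"
  then have p: "p \<in> Omega a" "p $ 2 \<noteq> 0"
    and D0: "((\<lambda>z. 1 - defect a z) has_derivative (\<lambda>v. 0)) (at p within Omega a - E)"
    by (auto simp: critical_point_on_def E_def)
  let ?e = "axis 2 (p $ 2) :: complex ^ 2"
  \<comment> \<open>Parametrised so that \<open>t\<close> scales the second coordinate and
    \<open>\<gamma> 1 = p\<close>. Criticality gives derivative 0 along this path at 1, while the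
    explicit formula gives \<open>2 * defect a p\<close>.\<close>
  define \<gamma> where "\<gamma> t = p + (t - 1) *\<^sub>R ?e" for t :: real
  have \<gamma>_nth: "\<gamma> t $ 1 = p $ 1" "\<gamma> t $ 2 = t *\<^sub>R p $ 2" for t
    by (auto simp: \<gamma>_def axis_def scaleR_left_diff_distrib)
  have \<gamma>_in: "\<gamma> ` {0<..<1} \<subseteq> Omega a - E"
  proof (clarsimp, intro conjI)
    fix t :: real
    assume t: "0 < t" "t < 1"
    have "cmod (t *\<^sub>R p $ 2) \<le> cmod (p $ 2)"
      using t by (simp add: mult_left_le_one_le)
    then show "\<gamma> t \<in> Omega a"
      using p(1) unfolding Omega_def mem_Collect_eq \<gamma>_nth by (rule order_trans)
    show "\<gamma> t \<notin> E"
      using t p by (simp add: E_def \<gamma>_nth)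
  qed
  have \<gamma>1: "\<gamma> 1 = p"
    by (simp add: \<gamma>_def)
  have \<gamma>_deriv: "(\<gamma> has_derivative (\<lambda>t. t *\<^sub>R ?e)) F" for F
    unfolding \<gamma>_def by (auto intro!: derivative_eq_intros)
  have "((\<lambda>t. 1 - defect a (\<gamma> t)) has_derivative (\<lambda>t. 0)) (at 1 within {0<..<1})"
    using has_derivative_in_compose[OF \<gamma>_deriv, of "\<lambda>z. 1 - defect a z" "\<lambda>v. 0" 1 "{0<..<1}"]
      has_derivative_subset[OF D0 \<gamma>_in] by (simp add: \<gamma>1)
  then have 0: "((\<lambda>t. 1 - defect a (\<gamma> t)) has_vector_derivative 0) (at 1 within {0<..<1})"
    by (simp add: has_vector_derivative_def)
  have "((\<lambda>z. 1 - defect a z) has_derivative (\<lambda>v. - (defect a p * log_defect_deriv a p v)))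
      (at p within \<gamma> ` {0<..<1})"
    using has_derivative_defect[OF p(2)]
    by (auto intro!: derivative_eq_intros intro: has_derivative_at_withinI)
  then have "((\<lambda>t. 1 - defect a (\<gamma> t)) has_derivative
      (\<lambda>t. - (defect a p * log_defect_deriv a p (t *\<^sub>R ?e)))) (at 1 within {0<..<1})"
    using has_derivative_in_compose[OF \<gamma>_deriv, of "\<lambda>z. 1 - defect a z" _ 1 "{0<..<1}"]
    by (simp add: \<gamma>1)
  moreover have "log_defect_deriv a p (t *\<^sub>R ?e) = - 2 * t" for t
    using p(2) by (simp add: log_defect_deriv_def axis_def scaleR_conv_of_real[of _ "p $ 2"])
  ultimately have 1: "((\<lambda>t. 1 - defect a (\<gamma> t)) has_vector_derivative (2 * defect a p))
      (at 1 within {0<..<1})"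
    by (simp add: has_vector_derivative_def mult_ac)
  \<comment> \<open>1 is a limit point of the interval, so even the one-sided derivative is
    unique.\<close>
  have "at 1 within {0<..<1} \<noteq> (bot :: real filter)"
    by (simp add: trivial_limit_within islimpt_greaterThanLessThan2)
  then have "2 * defect a p = 0"
    using vector_derivative_unique_within[OF _ 1 0] by simp
  then show False
    using p(2) by (simp add: defect_def)
qed

theorem proposition2p11:
  fixes a :: real
  assumes "a > 0"
  shows "\<exists>\<psi> :: complex ^ 2 \<Rightarrow> real.
    strictly_plurisuperharmonic_on (Omega a - E) \<psi> \<and>
    (\<nexists>p. critical_point_on (Omega a - E) \<psi> p) \<and>
    {z \<in> Omega a - E. \<psi> z = 0} = bd_Omega a \<and>
    {z \<in> Omega a - E. \<psi> z \<in> {..0}} = Omega a - E"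
proof (intro exI[of _ "\<lambda>z. 1 - defect a z"] conjI)
  \<comment> \<open>The formula is smooth on the open set \<open>- E\<close>, so at every point,
    boundary points included, the function serves as its own local extension.\<close>
  show "strictly_plurisuperharmonic_on (Omega a - E) (\<lambda>z. 1 - defect a z)"
    unfolding strictly_plurisuperharmonic_on_def local_smooth_extension_def
  proof (intro ballI exI conjI)
    fix p
    assume "p \<in> Omega a - E"
    then show "p \<in> - E" "neg_definite (complex_hessian (\<lambda>z. 1 - defect a z) p)"
      using neg_definite_complex_hessian_psi[OF assms] by (auto simp: E_def)
  qed (use open_Compl_E smooth_on_defect in auto)
  show "\<nexists>p. critical_point_on (Omega a - E) (\<lambda>z. 1 - defect a z) p"
    using no_critical_point_psi by blast
  have eq_1: "defect a z = 1 \<longleftrightarrow> cmod (z $ 2) = exp ((cmod (z $ 1))\<^sup>2 / a - a)" if "z $ 2 \<noteq> 0" for z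
    using that by (auto simp: defect_eq_power2 power2_eq_1_iff field_simps)
  have ge_1: "defect a z \<ge> 1" if "z \<in> Omega a" "z $ 2 \<noteq> 0" for z
    using that by (auto simp: defect_eq_power2 Omega_def intro!: one_le_power)
  \<comment> \<open>The exponential is positive, so \<open>bd_Omega a\<close> misses
    \<open>E\<close> and no boundary point is lost by removing \<open>E\<close>.\<close>
  have "z $ 2 \<noteq> 0" if "z \<in> bd_Omega a" for z
    using that by (metis (mono_tags) bd_Omega_def exp_not_eq_zero mem_Collect_eq norm_zero)
  with eq_1 show "{z \<in> Omega a - E. 1 - defect a z = 0} = bd_Omega a"
    by (auto simp: E_def Omega_def bd_Omega_def)
  show "{z \<in> Omega a - E. 1 - defect a z \<in> {..0}} = Omega a - E"
    using ge_1 by (auto simp: E_def)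
qed

end
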